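(* Let $G$ be a connected hypergraph with $m$ edges. The following are equivalent. (1) $G$ is minimal non-odd-transversal. (2) $m$ is odd, $\sum_{e \in E(G)}\chi_e=0$ over $\mathbb{Z}_2$, and $\sum_{e \in F} \chi_e \neq 0$ over $\mathbb{Z}_2$ for every nonempty proper subset $F$ of $E(G)$. (3) $m$ is odd, $\sum_{e \in E(G)}\chi_e=0$ over $\mathbb{Z}_2$, and $\operatorname{rank} B_G=m-1$ over $\mathbb{Z}_2$. (4) $m$ is odd, each vertex of $G$ has even degree, and every nonempty proper edge-induced sub-hypergraph of $G$ contains a vertex of odd degree (degree taken in that sub-hypergraph).
   Context: A hypergraph $G=(V,E)$ has a finite vertex set $V$ and an edge set $E$ consisting of distinct nonempty subsets of $V$ (no multiple edges), and no isolated vertices (every vertex lies in some edge). The degree of a vertex is the number of edges containing it. $G$ is connected if any two vertices are joined by a walk $v_0e_1v_1\dots e_tv_t$ with $\{v_{i-1},v_i\}\subseteq e_i$. A subset $U\subseteq V$ is an odd transversal if every edge meets $U$ in an odd number of vertices; $G$ is odd-transversal if it has an odd transversal. $G$ is minimal non-odd-transversal if it is not odd-transversal but $G-e$ (delete the edge $e$ from $E(G)$) is odd-transversal for every edge $e$. For $F\subseteq E(G)$, the edge-induced sub-hypergraph $G|_F$ has vertex set $\bigcup_{e\in F}e$ and edge set $F$. For an edge $e$, $\chi_e\in\mathbb{Z}_2^{V(G)}$ is its indicator vector ($\chi_e(v)=1$ iff $v\in e$). The incidence matrix $B_G$ is the $|E(G)|\times|V(G)|$ matrix with rows $\chi_e$,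 $e\in E(G)$, viewed over $\mathbb{Z}_2$. *)

theory Defs
  imports "Jordan_Normal_Form.DL_Rank" "HOL-Library.Z2" "HOL-Library.Function_Algebras"
begin

record 'a hgraph =
  hverts :: "'a set"
  hedges :: "'a set set"

definition hypergraph :: "'a hgraph \<Rightarrow> bool" where
  "hypergraph G \<longleftrightarrow>
     finite (hverts G) \<and>
     (\<forall>e\<in>hedges G. e \<noteq> {} \<and> e \<subseteq> hverts G) \<and>
     (\<forall>v\<in>hverts G. \<exists>e\<in>hedges G. v \<in> e)"

definition hdegree :: "'a hgraph \<Rightarrow> 'a \<Rightarrow> nat" where
  "hdegree G v = card {e \<in> hedges G. v \<in> e}"

text \<open>The walk \<open>v\<^sub>0 e\<^sub>1 v\<^sub>1 \<dots> e\<^sub>t v\<^sub>t\<close> is given by its vertices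
  \<open>[v\<^sub>0, \<dots>, v\<^sub>t]\<close> and its edges \<open>[e\<^sub>1, \<dots>, e\<^sub>t]\<close>, so \<open>e\<^sub>i\<close> is entry \<open>i - 1\<close>
  of the second list; \<open>t = 0\<close> is allowed.\<close>

definition hwalk :: "'a hgraph \<Rightarrow> 'a list \<Rightarrow> 'a set list \<Rightarrow> bool" where
  "hwalk G vs es \<longleftrightarrow>
     length vs = Suc (length es) \<and> set vs \<subseteq> hverts G \<and> set es \<subseteq> hedges G \<and>
     (\<forall>i<length es. {vs ! i, vs ! Suc i} \<subseteq> es ! i)"

definition hconnected :: "'a hgraph \<Rightarrow> bool" where
  "hconnected G \<longleftrightarrow>
     (\<forall>u\<in>hverts G. \<forall>v\<in>hverts G. \<exists>vs es. hwalk G vs es \<and> hd vs = u \<and> last vs = v)"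

definition is_odd_transversal :: "'a hgraph \<Rightarrow> 'a set \<Rightarrow> bool" where
  "is_odd_transversal G U \<longleftrightarrow> U \<subseteq> hverts G \<and> (\<forall>e\<in>hedges G. odd (card (e \<inter> U)))"

definition odd_transversal :: "'a hgraph \<Rightarrow> bool" where
  "odd_transversal G \<longleftrightarrow> (\<exists>U. is_odd_transversal G U)"

text \<open>Deleting an edge keeps all vertices, so the result may have isolated vertices
  and need not satisfy \<^const>\<open>hypergraph\<close>.\<close>

definition delete_edge :: "'a hgraph \<Rightarrow> 'a set \<Rightarrow> 'a hgraph" where
  "delete_edge G e = \<lparr>hverts = hverts G, hedges = hedges G - {e}\<rparr>"

definition minimal_non_odd_transversal :: "'a hgraph \<Rightarrow> bool" where
  "minimal_non_odd_transversal G \<longleftrightarrow>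
     \<not> odd_transversal G \<and> (\<forall>e\<in>hedges G. odd_transversal (delete_edge G e))"

text \<open>Meant for \<open>F \<subseteq> hedges G\<close>; the result depends on \<open>F\<close> only.\<close>

definition edge_induced :: "'a set set \<Rightarrow> 'a hgraph" where
  "edge_induced F = \<lparr>hverts = \<Union>F, hedges = F\<rparr>"

text \<open>A vector of \<open>\<int>\<^sub>2\<^bsup>V\<^esup>\<close> is represented by a function on the whole type that
  vanishes outside \<open>V\<close>; addition and \<open>0\<close> are pointwise.\<close>

definition edge_vec :: "'a set \<Rightarrow> 'a \<Rightarrow> bit" (\<open>\<chi>\<^sub>E\<close>) where
  "\<chi>\<^sub>E e v = (if v \<in> e then 1 else 0)"

text \<open>Rows and columns are ordered by duplicate-free enumerations \<open>es\<close> of the edges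
  and \<open>vs\<close> of the vertices.\<close>

definition incidence_mat :: "'a set list \<Rightarrow> 'a list \<Rightarrow> bit mat" where
  "incidence_mat es vs = mat (length es) (length vs) (\<lambda>(i, j). \<chi>\<^sub>E (es ! i) (vs ! j))"

text \<open>The dimension argument of \<^const>\<open>vec_space.rank\<close> is the length of the columns.\<close>

definition mat_rank :: "'a::field mat \<Rightarrow> nat" where
  "mat_rank A = vec_space.rank (dim_row A) A"

end

theory Submission
  imports Defs
begin

text \<open>Over \<open>\<int>\<^sub>2\<close>, an odd transversal is a solution of \<open>B\<^sub>G x = \<one>\<close>. By the Fredholm alternative it
  fails to exist iff some odd set of rows sums to zero. In a minimal obstruction this set must be all
  of \<open>E(G)\<close>, and a proper nonempty zero-sum set \<open>F\<close> is impossible since \<open>F\<close> or its complement is odd.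
  For the rank, if all rows sum to zero then the column space \<open>C\<close> lies in the hyperplane \<open>H\<close> of vectors
  with coordinate sum zero. Since \<open>C\<close> has \<open>2\<close> to the power \<open>rank B\<^sub>G\<close> elements, the rank is \<open>m - 1\<close> iff
  \<open>C = H\<close>, which by duality says that the only vectors orthogonal to \<open>C\<close> are \<open>0\<close> and \<open>\<one>\<close>.\<close>

text \<open>These rules rewrite \<open>+\<close> and \<open>*\<close> to bit operations, where ring lemmas no longer apply.\<close>

declare add_bit_eq_xor [simp del] mult_bit_eq_and [simp del]

section \<open>Arithmetic modulo 2\<close>

lemma bit_add_self [simp]: "(x::bit) + x = 0"
  by (cases x) simp_all

lemma card_UNIV_bit: "card (UNIV :: bit set) = 2"
proof -
  have "(UNIV :: bit set) = {0, 1}" by (auto intro: bit_not_zero_iff[THEN iffD1])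
  then show ?thesis by (metis card_2_iff zero_neq_one)
qed

lemma of_nat_bit_eq_0_iff: "(of_nat n :: bit) = 0 \<longleftrightarrow> even n"
  using Z2.bit_eq_iff[of "of_nat n" 0] by (simp only: even_of_nat even_zero simp_thms)

lemma of_nat_bit_eq_1_iff: "(of_nat n :: bit) = 1 \<longleftrightarrow> odd n"
  using of_nat_bit_eq_0_iff[of n] bit_not_zero_iff by metis

lemma sum_bit_indicator:
  fixes P :: "'b \<Rightarrow> bool"
  assumes "finite A"
  shows "(\<Sum>x\<in>A. if P x then 1 else (0::bit)) = of_nat (card {x \<in> A. P x})"
  using assms by (simp flip: sum.inter_filter)

lemma sum_fun_apply: "(\<Sum>i\<in>A. f i) x = (\<Sum>i\<in>A. f i x)"
  for f :: "'i \<Rightarrow> 'b \<Rightarrow> 'c::comm_monoid_add"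
  by (induction A rule: infinite_finite_induct) auto


section \<open>Linear algebra over the field with two elements\<close>

text \<open>Fredholm alternative over the two-element field: a vector \<open>w\<close> outside the
  span of the \<open>f i\<close> is detected by a functional \<open>z\<close> that kills the span.
  Coefficients are 0 or 1, so the span consists of the sums over subsets \<open>F\<close>.\<close>

lemma bit_separation:
  fixes f :: "'i \<Rightarrow> 'v \<Rightarrow> bit" and w :: "'v \<Rightarrow> bit"
  assumes "finite I" "finite V"
    and "\<And>F. F \<subseteq> I \<Longrightarrow> \<exists>v\<in>V. w v \<noteq> (\<Sum>i\<in>F. f i v)"
  shows "\<exists>z. (\<forall>i\<in>I. (\<Sum>v\<in>V. z v * f i v) = 0) \<and> (\<Sum>v\<in>V. z v * w v) = 1"
  using assms(1,3)
proof (induction I arbitrary: w rule: finite_induct)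
  case empty
  \<comment> \<open>\<open>F = {}\<close> gives a coordinate where \<open>w\<close> is nonzero;
    evaluation there is the required functional.\<close>
  from empty[of "{}"] obtain v where v: "v \<in> V" "w v = 1" by auto
  have "(\<Sum>u\<in>V. (if u = v then 1 else 0) * w u) = (\<Sum>u\<in>V. if u = v then w u else 0)"
    by (rule sum.cong) auto
  also have "\<dots> = 1" using v assms(2) by simp
  finally show ?case by (intro exI[of _ "\<lambda>u. if u = v then 1 else 0"]) simp
next
  case (insert e I)
  have "\<exists>v\<in>V. w v \<noteq> (\<Sum>i\<in>F. f i v)" if "F \<subseteq> I" for F
    using insert.prems[of F] that by blast
  from insert.IH[OF this] obtain z1 where
    z1: "\<forall>i\<in>I. (\<Sum>v\<in>V. z1 v * f i v) = 0" "(\<Sum>v\<in>V. z1 v * w v) = 1" by blast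
  \<comment> \<open>Neither \<open>w\<close> nor \<open>w + f e\<close> lies in the span of the
    remaining vectors, so the induction hypothesis yields a functional for each.\<close>
  have "\<exists>v\<in>V. w v + f e v \<noteq> (\<Sum>i\<in>F. f i v)" if F: "F \<subseteq> I" for F
  proof -
    have "e \<notin> F" "finite F" using insert.hyps F finite_subset by auto
    from insert.prems[of "insert e F"] F obtain v
      where "v \<in> V" "w v \<noteq> (\<Sum>i\<in>insert e F. f i v)" by auto
    then have "w v \<noteq> f e v + (\<Sum>i\<in>F. f i v)" using \<open>e \<notin> F\<close> \<open>finite F\<close> by simp
    then have "w v + f e v \<noteq> (\<Sum>i\<in>F. f i v)"
      by (cases "w v"; cases "f e v"; cases "\<Sum>i\<in>F. f i v") simp_all
    with \<open>v \<in> V\<close> show ?thesis by blast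
  qed
  from insert.IH[OF this] obtain z2 where
    z2: "\<forall>i\<in>I. (\<Sum>v\<in>V. z2 v * f i v) = 0" "(\<Sum>v\<in>V. z2 v * (w v + f e v)) = 1" by blast
  have z2': "(\<Sum>v\<in>V. z2 v * w v) + (\<Sum>v\<in>V. z2 v * f e v) = 1"
    using z2(2) by (simp add: distrib_left sum.distrib)
  consider "(\<Sum>v\<in>V. z1 v * f e v) = 0" | "(\<Sum>v\<in>V. z2 v * f e v) = 0"
    | "(\<Sum>v\<in>V. z1 v * f e v) = 1" "(\<Sum>v\<in>V. z2 v * f e v) = 1"
    using bit_not_zero_iff by blast
  then show ?case
  proof cases
    case 1
    then show ?thesis using z1 by auto
  next
    case 2
    then show ?thesis using z2 z2' by auto
  next
    \<comment> \<open>Here neither functional kills \<open>f e\<close>, but their sum does; as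
      \<open>z2\<close> vanishes on \<open>w\<close>, the sum still takes the value 1 there.\<close>
    case 3
    then have "(\<Sum>v\<in>V. z2 v * w v) = 0" using z2' by (cases "\<Sum>v\<in>V. z2 v * w v") simp_all
    then show ?thesis using z1 z2(1) 3
      by (intro exI[of _ "\<lambda>v. z1 v + z2 v"]) (simp add: distrib_right sum.distrib)
  qed
qed

text \<open>Coordinates with respect to a finite basis biject the space with tuples of scalars. This
  lets dimensions be compared by counting.\<close>

lemma (in vectorspace) card_carrier_eq_power_dim:
  assumes "fin_dim"
  shows "card (carrier V) = card (carrier K) ^ dim"
proof -
  obtain A where A: "finite A" "basis A" using finite_basis_exists[OF assms] by blast
  then have AV: "A \<subseteq> carrier V" by (simp add: basis_def)
  have ex1: "\<exists>!a. a \<in> A \<rightarrow>\<^sub>E carrier K \<and> lincomb a A = v" if "v \<in> carrier V" for v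
    using basis_criterion[OF A(1) AV] A(2) that by blast
  have closed: "lincomb a A \<in> carrier V" if "a \<in> A \<rightarrow>\<^sub>E carrier K" for a
    using that A(1) AV by (intro lincomb_closed) auto
  have "bij_betw (\<lambda>a. lincomb a A) (A \<rightarrow>\<^sub>E carrier K) (carrier V)"
    unfolding bij_betw_def inj_on_def using ex1 closed by blast
  then have "card (carrier V) = card (A \<rightarrow>\<^sub>E carrier K)" by (simp add: bij_betw_same_card)
  then show ?thesis using A dim_basis by (simp add: card_funcsetE)
qed

lemma card_carrier_vec_bit: "card (carrier_vec n :: bit vec set) = 2 ^ n"
proof -
  interpret vec_space "TYPE(bit)" n .
  show ?thesis
    using card_carrier_eq_power_dim dim_is_n by (simp add: card_UNIV_bit)
qed

lemma finite_carrier_vec_bit: "finite (carrier_vec n :: bit vec set)"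
  by (rule card_ge_0_finite) (simp add: card_carrier_vec_bit)

lemma card_col_space_bit:
  fixes A :: "bit mat"
  assumes A: "A \<in> carrier_mat n k"
  shows "card {A *\<^sub>v x | x. x \<in> carrier_vec k} = 2 ^ mat_rank A"
proof -
  interpret vec_space "TYPE(bit)" n .
  have cols: "set (cols A) \<subseteq> carrier_vec n" using A cols_dim by blast
  then have vs: "vectorspace class_ring (span_vs (set (cols A)))"
    using span_is_subspace subspace_is_vs by simp
  have "card (span (set (cols A))) = 2 ^ rank A"
    using vectorspace.card_carrier_eq_power_dim[OF vs fin_dim_span_cols[OF A]]
    by (simp add: rank_def card_UNIV_bit)
  moreover have "span (set (cols A)) = {A *\<^sub>v x | x. x \<in> carrier_vec k}"
    using col_space_eq[OF A] A unfolding col_space_def by auto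
  ultimately show ?thesis using A by (simp add: mat_rank_def)
qed

text \<open>Flipping coordinate 0 is an involution that exchanges even and odd weight, so each class
  is half of the space.\<close>

lemma card_even_weight_vecs:
  assumes "n > 0"
  shows "card {y \<in> carrier_vec n. (\<Sum>i<n. y $ i) = (0::bit)} = 2 ^ (n - 1)" (is "card ?H = _")
proof -
  let ?H' = "{y \<in> carrier_vec n. (\<Sum>i<n. y $ i) = (1::bit)}"
  let ?f = "\<lambda>y. y + unit_vec n 0 :: bit vec"
  have inv: "?f (?f y) = y" if "y \<in> carrier_vec n" for y
    using that by (intro eq_vecI) (auto simp: add.assoc)
  have weight: "(\<Sum>i<n. ?f y $ i) = (\<Sum>i<n. y $ i) + 1" if "y \<in> carrier_vec n" for y
  proof -
    have "(\<Sum>i<n. ?f y $ i) = (\<Sum>i<n. y $ i + (if i = 0 then 1 else 0))"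
      using that assms by (intro sum.cong) auto
    then show ?thesis using assms by (simp add: sum.distrib)
  qed
  have "bij_betw ?f ?H ?H'"
    by (rule bij_betw_byWitness[where f' = ?f]) (auto simp: inv weight simp del: index_add_vec)
  then have eq: "card ?H = card ?H'" by (rule bij_betw_same_card)
  have fin: "finite ?H" "finite ?H'" by (simp_all add: finite_carrier_vec_bit)
  have "carrier_vec n = ?H \<union> ?H'" using bit_not_zero_iff by blast
  then have "2 ^ n = card (?H \<union> ?H')" using card_carrier_vec_bit by metis
  also have "\<dots> = 2 * card ?H" using eq fin by (subst card_Un_disjoint) auto
  finally show ?thesis using assms by (cases n) auto
qed


section \<open>Hypergraphs\<close>

lemma sum_edge_vec_apply:
  "finite F \<Longrightarrow> (\<Sum>e\<in>F. \<chi>\<^sub>E e) v = of_nat (card {e \<in> F. v \<in> e})"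
  by (simp add: sum_fun_apply edge_vec_def sum_bit_indicator)

lemma sum_edge_vec_eq_0_iff:
  "finite F \<Longrightarrow> (\<Sum>e\<in>F. \<chi>\<^sub>E e) = 0 \<longleftrightarrow> (\<forall>v. even (card {e \<in> F. v \<in> e}))"
  by (simp add: fun_eq_iff sum_edge_vec_apply of_nat_bit_eq_0_iff)

text \<open>The coordinate of the sum at \<open>v\<close> is the degree of \<open>v\<close> modulo
  2, and it vanishes off \<open>V\<close>. Leaving \<open>V\<close> free covers both
  \<open>G\<close> and its edge-induced sub-hypergraphs.\<close>

lemma sum_edge_vec_eq_0_iff_hdegree:
  assumes "finite F" "\<Union>F \<subseteq> V"
  shows "(\<Sum>e\<in>F. \<chi>\<^sub>E e) = 0 \<longleftrightarrow> (\<forall>v\<in>V. even (hdegree \<lparr>hverts = V, hedges = F\<rparr> v))"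
proof -
  have "{e \<in> F. v \<in> e} = {}" if "v \<notin> V" for v using assms(2) that by blast
  then have "even (card {e \<in> F. v \<in> e})" if "v \<notin> V" for v
    using that by (metis card.empty even_zero)
  then show ?thesis using assms(1) by (auto simp: sum_edge_vec_eq_0_iff hdegree_def)
qed

section \<open>Odd transversals and zero-sum edge sets\<close>

lemma sum_edge_vec_inter:
  assumes "finite V" "e \<subseteq> V"
  shows "(\<Sum>v\<in>V. z v * \<chi>\<^sub>E e v) = of_nat (card (e \<inter> {v \<in> V. z v = 1}))"
proof -
  have "(\<Sum>v\<in>V. z v * \<chi>\<^sub>E e v) = (\<Sum>v\<in>V. if v \<in> e \<and> z v = 1 then 1 else 0)"
    by (rule sum.cong) (auto simp: edge_vec_def)
  also have "\<dots> = of_nat (card {v \<in> V. v \<in> e \<and> z v = 1})"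
    using assms(1) by (rule sum_bit_indicator)
  also have "{v \<in> V. v \<in> e \<and> z v = 1} = e \<inter> {v \<in> V. z v = 1}" using assms(2) by auto
  finally show ?thesis .
qed

text \<open>The hypotheses are chosen to hold for \<open>delete_edge G e\<close> too, which may have
  isolated vertices.\<close>

lemma odd_transversal_iff_no_odd_zero_sum:
  assumes fin: "finite (hverts G)" and sub: "\<And>e. e \<in> hedges G \<Longrightarrow> e \<subseteq> hverts G"
  shows "odd_transversal G \<longleftrightarrow>
    \<not> (\<exists>F\<subseteq>hedges G. odd (card F) \<and> (\<Sum>e\<in>F. \<chi>\<^sub>E e) = 0)" (is "_ \<longleftrightarrow> \<not> ?dep")
proof
  let ?V = "hverts G"
  assume "odd_transversal G"
  then obtain U where U: "U \<subseteq> ?V" "\<And>e. e \<in> hedges G \<Longrightarrow> odd (card (e \<inter> U))"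
    unfolding odd_transversal_def is_odd_transversal_def by blast
  show "\<not> ?dep"
  proof
    assume ?dep
    then obtain F where F: "F \<subseteq> hedges G" "odd (card F)" "(\<Sum>e\<in>F. \<chi>\<^sub>E e) = 0" by blast
    define z :: "'a \<Rightarrow> bit" where "z v = (if v \<in> U then 1 else 0)" for v
    have Uz: "{v \<in> ?V. z v = 1} = U" using U(1) by (auto simp: z_def)
    have "(\<Sum>v\<in>?V. z v * \<chi>\<^sub>E e v) = 1" if "e \<in> F" for e
    proof -
      have "odd (card (e \<inter> U))" "e \<subseteq> ?V" using F(1) U(2) sub that by auto
      then show ?thesis
        using sum_edge_vec_inter[OF fin, of e z] of_nat_bit_eq_1_iff unfolding Uz by metis
    qed
    \<comment> \<open>Double counting: each edge of \<open>F\<close> contributes 1, giving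
      \<open>card F\<close> modulo 2, while summing over the edges first gives 0.\<close>
    then have "(\<Sum>e\<in>F. \<Sum>v\<in>?V. z v * \<chi>\<^sub>E e v) = of_nat (card F)" by simp
    also have "(\<Sum>e\<in>F. \<Sum>v\<in>?V. z v * \<chi>\<^sub>E e v) = (\<Sum>v\<in>?V. z v * (\<Sum>e\<in>F. \<chi>\<^sub>E e) v)"
      by (subst sum.swap) (simp add: sum_fun_apply sum_distrib_left)
    also have "\<dots> = 0" by (simp add: F(3))
    finally show False using F(2) of_nat_bit_eq_0_iff by metis
  qed
next
  assume nodep: "\<not> ?dep"
  let ?V = "hverts G" and ?E = "hedges G"
  have finE: "finite ?E"
    using fin sub by (intro finite_subset[of ?E "Pow ?V"]) auto
  \<comment> \<open>An inhomogeneous system becomes a separation problem after adding one coordinate \<^const>\<open>None\<close>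
    that holds the right-hand side.\<close>
  let ?W = "insert None (Some ` ?V)"
  let ?f = "\<lambda>e. case_option 1 (\<chi>\<^sub>E e)" and ?w = "case_option (1::bit) (\<lambda>_. 0)"
  have "\<exists>v\<in>?W. ?w v \<noteq> (\<Sum>e\<in>F. ?f e v)" if F: "F \<subseteq> ?E" for F
  proof (rule ccontr)
    assume "\<not> ?thesis"
    then have eq: "?w v = (\<Sum>e\<in>F. ?f e v)" if "v \<in> ?W" for v using that by blast
    \<comment> \<open>Coordinate \<open>None\<close> of the equation records the parity of
      \<open>F\<close>; the \<open>Some\<close> coordinates say that its edges sum to zero.\<close>
    have "odd (card F)" using eq[of None] of_nat_bit_eq_1_iff[of "card F"] by simp
    have "(\<Sum>e\<in>F. \<chi>\<^sub>E e) v = 0" for v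
    proof (cases "v \<in> ?V")
      case True
      then show ?thesis using eq[of "Some v"] by (simp add: sum_fun_apply)
    next
      case False
      then have "\<chi>\<^sub>E e v = 0" if "e \<in> F" for e using that F sub by (auto simp: edge_vec_def)
      then show ?thesis by (simp add: sum_fun_apply)
    qed
    then have "(\<Sum>e\<in>F. \<chi>\<^sub>E e) = 0" by (simp add: fun_eq_iff)
    then show False using nodep F \<open>odd (card F)\<close> by blast
  qed
  then obtain z where z: "\<forall>e\<in>?E. (\<Sum>v\<in>?W. z v * ?f e v) = 0" "(\<Sum>v\<in>?W. z v * ?w v) = 1"
    using bit_separation[OF finE, of ?W ?w ?f] fin by auto
  have split: "(\<Sum>v\<in>?W. z v * g v) = z None * g None + (\<Sum>v\<in>?V. z (Some v) * g (Some v))" for g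
    using fin by (simp add: sum.reindex)
  \<comment> \<open>\<open>?w\<close> is supported on \<open>None\<close>, so pairing it with
    \<open>z\<close> reads off \<open>z None\<close>; orthogonality to \<open>?f e\<close> then
    becomes the equation for \<open>e\<close> with right-hand side 1.\<close>
  have "z None = 1" using z(2) by (simp add: split)
  define U where "U = {v \<in> ?V. z (Some v) = 1}"
  have "odd (card (e \<inter> U))" if e: "e \<in> ?E" for e
  proof -
    have "1 + (\<Sum>v\<in>?V. z (Some v) * \<chi>\<^sub>E e v) = 0"
      using z(1) e \<open>z None = 1\<close> by (simp add: split)
    then have "(\<Sum>v\<in>?V. z (Some v) * \<chi>\<^sub>E e v) = 1"
      by (cases "\<Sum>v\<in>?V. z (Some v) * \<chi>\<^sub>E e v") simp_all
    then show ?thesis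
      using sum_edge_vec_inter[OF fin sub[OF e], of "\<lambda>v. z (Some v)"]
      unfolding U_def by (metis of_nat_bit_eq_1_iff)
  qed
  moreover have "U \<subseteq> ?V" by (auto simp: U_def)
  ultimately show "odd_transversal G"
    unfolding odd_transversal_def is_odd_transversal_def by blast
qed

lemma minimal_non_odd_transversal_iff:
  assumes fin: "finite (hverts G)" and sub: "\<And>e. e \<in> hedges G \<Longrightarrow> e \<subseteq> hverts G"
  shows "minimal_non_odd_transversal G \<longleftrightarrow>
    odd (card (hedges G)) \<and> (\<Sum>e\<in>hedges G. \<chi>\<^sub>E e) = 0 \<and>
    (\<forall>F. F \<noteq> {} \<and> F \<subset> hedges G \<longrightarrow> (\<Sum>e\<in>F. \<chi>\<^sub>E e) \<noteq> 0)" (is "_ \<longleftrightarrow> ?R")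
proof -
  let ?E = "hedges G"
  have finE: "finite ?E"
    using fin sub by (intro finite_subset[of ?E "Pow (hverts G)"]) auto
  define Z where "Z F \<longleftrightarrow> (\<Sum>e\<in>F. \<chi>\<^sub>E e) = 0" for F :: "'a set set"
  have G: "odd_transversal G \<longleftrightarrow> \<not> (\<exists>F\<subseteq>?E. odd (card F) \<and> Z F)"
    unfolding Z_def using fin sub by (rule odd_transversal_iff_no_odd_zero_sum)
  have del: "odd_transversal (delete_edge G e) \<longleftrightarrow> \<not> (\<exists>F\<subseteq>?E - {e}. odd (card F) \<and> Z F)" for e
    unfolding Z_def using fin sub odd_transversal_iff_no_odd_zero_sum[of "delete_edge G e"]
    by (simp add: delete_edge_def)
  have proper: "F \<subset> ?E \<longleftrightarrow> (\<exists>e\<in>?E. F \<subseteq> ?E - {e})" for F by blast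
  \<comment> \<open>An odd zero-sum set exists, and none survives the deletion of an edge; hence it
    can only be the full edge set.\<close>
  have L: "minimal_non_odd_transversal G \<longleftrightarrow>
      odd (card ?E) \<and> Z ?E \<and> (\<forall>F. F \<subset> ?E \<and> odd (card F) \<longrightarrow> \<not> Z F)"
    unfolding minimal_non_odd_transversal_def G del proper
    using proper by (metis order_refl psubset_eq)
  have compl: "Z F \<longleftrightarrow> Z (?E - F)" if "F \<subseteq> ?E" "Z ?E" for F
  proof -
    have "(\<Sum>e\<in>?E. \<chi>\<^sub>E e) = (\<Sum>e\<in>?E - F. \<chi>\<^sub>E e) + (\<Sum>e\<in>F. \<chi>\<^sub>E e)"
      using that(1) finE by (rule sum.subset_diff)
    then show ?thesis using that(2) by (auto simp: Z_def)
  qed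
  have "odd (card F) \<or> odd (card (?E - F))" if "F \<subseteq> ?E" "odd (card ?E)" for F
    using that finE card_Diff_subset[of F ?E] finite_subset[of F ?E] card_mono[of ?E F] by auto
  \<comment> \<open>Nonemptiness of \<open>F\<close> makes its complement proper, so the ban on odd
    proper zero-sum sets reaches even \<open>F\<close> through \<open>compl\<close>.\<close>
  then have "odd (card F) \<or> odd (card (?E - F)) \<and> ?E - F \<subset> ?E"
    if "F \<noteq> {}" "F \<subset> ?E" "odd (card ?E)" for F
    using that by blast
  then have "(\<forall>F. F \<subset> ?E \<and> odd (card F) \<longrightarrow> \<not> Z F) \<longleftrightarrow>
      (\<forall>F. F \<noteq> {} \<and> F \<subset> ?E \<longrightarrow> \<not> Z F)" if "odd (card ?E)" "Z ?E"
    using that compl by (metis card.empty even_zero psubset_imp_subset)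
  then show ?thesis unfolding L Z_def by blast
qed

section \<open>The rank of the incidence matrix\<close>

lemma incidence_mat_carrier: "incidence_mat es vs \<in> carrier_mat (length es) (length vs)"
  by (simp add: incidence_mat_def)

lemma incidence_mat_mult_vec:
  assumes "i < length es" "x \<in> carrier_vec (length vs)"
  shows "(incidence_mat es vs *\<^sub>v x) $ i = (\<Sum>j<length vs. \<chi>\<^sub>E (es ! i) (vs ! j) * x $ j)"
proof -
  have "(incidence_mat es vs *\<^sub>v x) $ i = row (incidence_mat es vs) i \<bullet> x"
    using assms by (simp add: incidence_mat_def)
  also have "\<dots> = (\<Sum>j<length vs. row (incidence_mat es vs) i $ j * x $ j)"
    using assms by (simp add: scalar_prod_def flip: atLeast0LessThan)
  also have "\<dots> = (\<Sum>j<length vs. \<chi>\<^sub>E (es ! i) (vs ! j) * x $ j)"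
    using assms by (intro sum.cong) (simp_all add: incidence_mat_def)
  finally show ?thesis .
qed

lemma rank_incidence_mat_iff:
  assumes dist: "distinct es"
    and sub: "\<And>e. e \<in> set es \<Longrightarrow> e \<subseteq> set vs"
    and ne: "es \<noteq> []" and zero: "(\<Sum>e\<in>set es. \<chi>\<^sub>E e) = 0"
  shows "mat_rank (incidence_mat es vs) = length es - 1 \<longleftrightarrow>
    (\<forall>F. F \<noteq> {} \<and> F \<subset> set es \<longrightarrow> (\<Sum>e\<in>F. \<chi>\<^sub>E e) \<noteq> 0)"
proof -
  let ?A = "incidence_mat es vs" and ?m = "length es" and ?k = "length vs"
  define C where "C = {?A *\<^sub>v x | x. x \<in> carrier_vec ?k}"
  define H :: "bit vec set" where "H = {y \<in> carrier_vec ?m. (\<Sum>i<?m. y $ i) = 0}"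
  have sum_es: "(\<Sum>i<?m. g (es ! i)) = (\<Sum>e\<in>set es. g e)" for g :: "'a set \<Rightarrow> bit"
    using sum.reindex_bij_betw[OF bij_betw_nth[OF dist refl refl]] .
  \<comment> \<open>The indicator of a zero-sum edge set is a left null vector of \<open>?A\<close>,
    hence orthogonal to every column combination.\<close>
  have orth: "(\<Sum>i<?m. (if es ! i \<in> F then 1 else 0) * y $ i) = 0"
    if F: "F \<subseteq> set es" "(\<Sum>e\<in>F. \<chi>\<^sub>E e) = 0" and y: "y \<in> C" for F y
  proof -
    obtain x where x: "x \<in> carrier_vec ?k" "y = ?A *\<^sub>v x" using y C_def by blast
    let ?c = "\<lambda>e. if e \<in> F then 1 else (0::bit)"
    have "(\<Sum>i<?m. ?c (es ! i) * y $ i) =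
        (\<Sum>i<?m. \<Sum>j<?k. ?c (es ! i) * (\<chi>\<^sub>E (es ! i) (vs ! j) * x $ j))"
      by (intro sum.cong refl) (simp add: x incidence_mat_mult_vec sum_distrib_left)
    also have "\<dots> = (\<Sum>j<?k. \<Sum>i<?m. ?c (es ! i) * (\<chi>\<^sub>E (es ! i) (vs ! j) * x $ j))"
      by (rule sum.swap)
    also have "\<dots> = (\<Sum>j<?k. (\<Sum>e\<in>set es. ?c e * \<chi>\<^sub>E e (vs ! j)) * x $ j)"
      by (simp flip: sum_es add: sum_distrib_right mult.assoc)
    also have "\<dots> = (\<Sum>j<?k. (\<Sum>e\<in>F. \<chi>\<^sub>E e) (vs ! j) * x $ j)"
    proof (intro sum.cong refl arg_cong2[where f = "(*)"])
      fix j
      have "(\<Sum>e\<in>set es. ?c e * \<chi>\<^sub>E e (vs ! j)) = (\<Sum>e\<in>set es. if e \<in> F then \<chi>\<^sub>E e (vs ! j) else 0)"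
        by (rule sum.cong) auto
      also have "\<dots> = (\<Sum>e\<in>F. \<chi>\<^sub>E e) (vs ! j)"
        using F(1) by (simp add: sum_fun_apply Int_absorb1 flip: sum.inter_restrict)
      finally show "(\<Sum>e\<in>set es. ?c e * \<chi>\<^sub>E e (vs ! j)) = (\<Sum>e\<in>F. \<chi>\<^sub>E e) (vs ! j)" .
    qed
    also have "\<dots> = 0" by (simp add: F(2))
    finally show ?thesis .
  qed
  have C_carrier: "C \<subseteq> carrier_vec ?m"
    unfolding C_def using incidence_mat_carrier[of es vs] by auto
  \<comment> \<open>Applied to the full edge set, \<open>orth\<close> gives orthogonality to the
    all-ones vector.\<close>
  have CH: "C \<subseteq> H"
  proof
    fix y assume y: "y \<in> C"
    have "(\<Sum>i<?m. y $ i) = (\<Sum>i<?m. (if es ! i \<in> set es then 1 else 0) * y $ i)"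
      by (rule sum.cong) auto
    also have "\<dots> = 0" using orth[OF order_refl zero y] .
    finally show "y \<in> H" using y C_carrier by (auto simp: H_def)
  qed
  have finH: "finite H" unfolding H_def by (simp add: finite_carrier_vec_bit)
  have cardC: "card C = 2 ^ mat_rank ?A"
    unfolding C_def by (rule card_col_space_bit[OF incidence_mat_carrier])
  have cardH: "card H = 2 ^ (?m - 1)"
    unfolding H_def using ne by (intro card_even_weight_vecs) simp
  have "mat_rank ?A = ?m - 1 \<longleftrightarrow> card C = card H"
    unfolding cardC cardH by simp
  also have "\<dots> \<longleftrightarrow> C = H" using card_subset_eq[OF finH CH] by blast
  also have "\<dots> \<longleftrightarrow> (\<forall>F. F \<noteq> {} \<and> F \<subset> set es \<longrightarrow> (\<Sum>e\<in>F. \<chi>\<^sub>E e) \<noteq> 0)"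
  proof
    assume "C = H"
    show "\<forall>F. F \<noteq> {} \<and> F \<subset> set es \<longrightarrow> (\<Sum>e\<in>F. \<chi>\<^sub>E e) \<noteq> 0"
    proof (intro allI impI notI)
      fix F assume F: "F \<noteq> {} \<and> F \<subset> set es" and F0: "(\<Sum>e\<in>F. \<chi>\<^sub>E e) = 0"
      then obtain a b where "a \<in> F" "a \<in> set es" "b \<notin> F" "b \<in> set es" by blast
      then obtain p q where pq: "p < ?m" "es ! p \<in> F" "q < ?m" "es ! q \<notin> F"
        by (metis in_set_conv_nth)
      \<comment> \<open>Weight two puts \<open>y\<close> in \<open>H\<close>, but exactly one of its
        two positions lies in \<open>F\<close>, so it pairs to 1 with the indicator of
        \<open>F\<close>.\<close>
      define y :: "bit vec" where "y = unit_vec ?m p + unit_vec ?m q"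
      have yi: "y $ i = (if i = p then 1 else 0) + (if i = q then 1 else 0)" if "i < ?m" for i
        using that pq by (simp add: y_def)
      have "(\<Sum>i<?m. y $ i) = (\<Sum>i<?m. (if i = p then 1 else 0) + (if i = q then 1 else 0))"
        by (rule sum.cong) (simp_all add: yi)
      also have "\<dots> = 0" using pq by (simp add: sum.distrib)
      finally have "y \<in> C" unfolding \<open>C = H\<close> by (simp add: H_def y_def)
      then have "0 = (\<Sum>i<?m. (if es ! i \<in> F then 1 else 0) * y $ i)"
        using orth[of F y] F F0 by auto
      also have "\<dots> = (\<Sum>i<?m. if i = p then 1 else 0)"
        using pq by (intro sum.cong) (auto simp: yi)
      finally show False using pq by simp
    qed
  next
    assume R: "\<forall>F. F \<noteq> {} \<and> F \<subset> set es \<longrightarrow> (\<Sum>e\<in>F. \<chi>\<^sub>E e) \<noteq> 0"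
    have "y \<in> C" if y: "y \<in> H" for y
    proof (rule ccontr)
      assume "y \<notin> C"
      have ycar: "y \<in> carrier_vec ?m" and y0: "(\<Sum>i<?m. y $ i) = 0" using y by (auto simp: H_def)
      have "\<exists>i\<in>{..<?m}. y $ i \<noteq> (\<Sum>j\<in>J. \<chi>\<^sub>E (es ! i) (vs ! j))" if J: "J \<subseteq> {..<?k}" for J
      proof (rule ccontr)
        assume "\<not> ?thesis"
        then have eq: "y $ i = (\<Sum>j\<in>J. \<chi>\<^sub>E (es ! i) (vs ! j))" if "i < ?m" for i using that by blast
        \<comment> \<open>Choosing the columns in \<open>J\<close> amounts to multiplying
          \<open>?A\<close> by the indicator of \<open>J\<close>.\<close>
        define x where "x = vec ?k (\<lambda>j. if j \<in> J then 1 else (0::bit))"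
        have x: "x \<in> carrier_vec ?k" by (simp add: x_def)
        have "y = ?A *\<^sub>v x"
        proof (rule eq_vecI)
          fix i assume "i < dim_vec (?A *\<^sub>v x)"
          then have i: "i < ?m" by (simp add: incidence_mat_def)
          have "(?A *\<^sub>v x) $ i = (\<Sum>j<?k. if j \<in> J then \<chi>\<^sub>E (es ! i) (vs ! j) else 0)"
            unfolding incidence_mat_mult_vec[OF i x] by (rule sum.cong) (auto simp: x_def)
          also have "\<dots> = (\<Sum>j\<in>J. \<chi>\<^sub>E (es ! i) (vs ! j))"
            using J by (simp add: Int_absorb1 flip: sum.inter_restrict)
          finally show "y $ i = (?A *\<^sub>v x) $ i" using eq[OF i] by simp
        qed (use ycar in \<open>simp add: incidence_mat_def\<close>)
        then show False using \<open>y \<notin> C\<close> x C_def by blast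
      qed
      \<comment> \<open>Separation is applied to the columns of \<open>?A\<close>, with edge indices
        as coordinates; \<open>z\<close> is thus a left null vector, and its support
        \<open>I\<close> picks out a zero-sum edge set.\<close>
      then obtain z where
        z: "\<forall>j\<in>{..<?k}. (\<Sum>i<?m. z i * \<chi>\<^sub>E (es ! i) (vs ! j)) = 0" "(\<Sum>i<?m. z i * y $ i) = 1"
        using bit_separation[of "{..<?k}" "{..<?m}" "\<lambda>i. y $ i" "\<lambda>j i. \<chi>\<^sub>E (es ! i) (vs ! j)"]
        by auto
      define I where "I = {i. i < ?m \<and> z i = 1}"
      define F where "F = (\<lambda>i. es ! i) ` I"
      have inj: "inj_on (\<lambda>i. es ! i) I"
        using dist by (auto simp: I_def inj_on_def nth_eq_iff_index_eq)
      have Fsub: "F \<subseteq> set es" by (auto simp: F_def I_def)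
      have "(\<Sum>e\<in>F. \<chi>\<^sub>E e) v = 0" for v
      proof (cases "v \<in> set vs")
        case True
        then obtain j where j: "j < ?k" "v = vs ! j" by (metis in_set_conv_nth)
        have "(\<Sum>e\<in>F. \<chi>\<^sub>E e) v = (\<Sum>i\<in>I. \<chi>\<^sub>E (es ! i) v)"
          by (simp add: sum_fun_apply F_def sum.reindex[OF inj])
        also have "\<dots> = (\<Sum>i<?m. z i * \<chi>\<^sub>E (es ! i) v)"
          by (intro sum.mono_neutral_cong_left) (auto simp: I_def)
        finally show ?thesis using z(1) j by simp
      next
        case False
        then have "\<chi>\<^sub>E e v = 0" if "e \<in> F" for e
          using that Fsub sub by (auto simp: edge_vec_def)
        then show ?thesis by (simp add: sum_fun_apply)
      qed
      then have "(\<Sum>e\<in>F. \<chi>\<^sub>E e) = 0" by (simp add: fun_eq_iff)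
      \<comment> \<open>These cases make \<open>z\<close> zero or all-ones on the edge indices. Both
        contradict \<open>z\<close> pairing to 1 with \<open>y\<close>, the second because
        \<open>y\<close> has even weight.\<close>
      then have "F = {} \<or> F = set es" using R Fsub by blast
      then show False
      proof
        assume "F = {}"
        then have "I = {}" by (simp add: F_def)
        then have "z i = 0" if "i < ?m" for i using that bit_not_one_iff by (auto simp: I_def)
        then show False using z(2) by simp
      next
        assume F: "F = set es"
        have "z i = 1" if "i < ?m" for i
        proof -
          have "es ! i \<in> F" using F that by simp
          then show ?thesis
            using that dist by (auto simp: F_def I_def nth_eq_iff_index_eq)
        qed
        then show False using z(2) y0 by simp
      qed
    qed
    then show "C = H" using CH by blast
  qed
  finally show ?thesis .
qed

theorem theorem3p4:
  fixes G :: "'a hgraph" and m :: nat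
    and es :: "'a set list" and vs :: "'a list"
  assumes "hypergraph G" and "hconnected G"
    and "m = card (hedges G)"
    and "distinct es" and "set es = hedges G"
    and "distinct vs" and "set vs = hverts G"
  defines "cond1 \<equiv> minimal_non_odd_transversal G"
    and "cond2 \<equiv> odd m \<and> (\<Sum>e\<in>hedges G. \<chi>\<^sub>E e) = 0 \<and>
           (\<forall>F. F \<noteq> {} \<and> F \<subset> hedges G \<longrightarrow> (\<Sum>e\<in>F. \<chi>\<^sub>E e) \<noteq> 0)"
    and "cond3 \<equiv> odd m \<and> (\<Sum>e\<in>hedges G. \<chi>\<^sub>E e) = 0 \<and>
           mat_rank (incidence_mat es vs) = m - 1"
    and "cond4 \<equiv> odd m \<and> (\<forall>v\<in>hverts G. even (hdegree G v)) \<and>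
           (\<forall>F. F \<noteq> {} \<and> F \<subset> hedges G \<longrightarrow>
              (\<exists>v\<in>hverts (edge_induced F). odd (hdegree (edge_induced F) v)))"
  shows "(cond1 \<longleftrightarrow> cond2) \<and> (cond2 \<longleftrightarrow> cond3) \<and> (cond3 \<longleftrightarrow> cond4)"
proof -
  have fin: "finite (hverts G)" and sub: "\<And>e. e \<in> hedges G \<Longrightarrow> e \<subseteq> hverts G"
    using assms(1) by (auto simp: hypergraph_def)
  have finE: "finite (hedges G)" using assms(5) by (metis List.finite_set)
  have m: "m = length es" using assms(3-5) distinct_card by metis
  have c12: "cond1 \<longleftrightarrow> cond2"
    unfolding cond1_def cond2_def assms(3) using fin sub by (rule minimal_non_odd_transversal_iff)
  have c23: "cond2 \<longleftrightarrow> cond3"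
    unfolding cond2_def cond3_def
  proof (intro conj_cong refl)
    assume "odd m" and zero: "(\<Sum>e\<in>hedges G. \<chi>\<^sub>E e) = 0"
    \<comment> \<open>Oddness of \<open>m\<close> excludes the empty edge set.\<close>
    then have "es \<noteq> []" using m by auto
    then show "(\<forall>F. F \<noteq> {} \<and> F \<subset> hedges G \<longrightarrow> (\<Sum>e\<in>F. \<chi>\<^sub>E e) \<noteq> 0) \<longleftrightarrow>
        mat_rank (incidence_mat es vs) = m - 1"
      using rank_incidence_mat_iff[of es vs] assms(4-7) sub zero m by simp
  qed
  have "(\<Sum>e\<in>hedges G. \<chi>\<^sub>E e) = 0 \<longleftrightarrow> (\<forall>v\<in>hverts G. even (hdegree G v))"
    using sum_edge_vec_eq_0_iff_hdegree[OF finE, of "hverts G"] sub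
    by (auto simp: hdegree_def)
  \<comment> \<open>Here the vertex set is that of the edge-induced sub-hypergraph, the union of
    \<open>F\<close>.\<close>
  moreover have "(\<Sum>e\<in>F. \<chi>\<^sub>E e) \<noteq> 0 \<longleftrightarrow>
      (\<exists>v\<in>hverts (edge_induced F). odd (hdegree (edge_induced F) v))" if "F \<subset> hedges G" for F
    using sum_edge_vec_eq_0_iff_hdegree[of F "\<Union>F"] finite_subset[of F, OF _ finE] that
    by (simp add: edge_induced_def psubset_eq)
  ultimately have "cond2 \<longleftrightarrow> cond4"
    unfolding cond2_def cond4_def by (metis (no_types, lifting))
  with c12 c23 show ?thesis by blast
qed

end
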